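(* For every $k\ge 1$, the Harmonic Algorithm for the generalized $k$-server problem on uniform metrics is $(k\cdot\alpha_k)$-competitive (against an adaptive online adversary), where $\alpha_1=1$ and $\alpha_\ell = 1+(\ell-1)\alpha_{\ell-1}$ for $\ell>1$.
   Context: Generalized $k$-server problem on uniform metrics: there are $k$ uniform metric spaces $M_1,\dots,M_k$, each with point set $[n]$ and all pairwise distances equal to $1$. A configuration is $q=(q_1,\dots,q_k)\in[n]^k$ (server $s_i$ is at point $q_i$ of $M_i$). A request is $r=(r_1,\dots,r_k)\in[n]^k$; it is served by a configuration $q$ if $q_i=r_i$ for some $i$, and otherwise some server must be moved so that this holds. Moving server $s_i$ to a different point costs $1$, so the cost of changing configuration from $q$ to $q'$ is the Hamming distance $d_H(q,q')=|\{i: q_i\neq q'_i\}|$. A randomized memoryless algorithm is given by a probability distribution $(p_1,\dots,p_k)$: on request $r$, if its current configuration serves $r$ it does nothing; otherwise it picks $i$ with probability $p_i$ and moves server $s_i$ to $r_i$. The Harmonic Algorithm is the memoryless algorithm with $p_i=1/k$ for all $i$. Competitiveness is measured against an adaptive online adversary that starts from the same initial configuration: an algorithm is $c$-competitive if for every (adaptive) request sequence its expected total cost is at most $c$ times the adversary's total cost (up to an additive constant). *)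

theory Defs
  imports "HOL-Probability.Probability"
begin

text \<open>Both configurations and requests are elements of \<open>[n]\<^sup>k\<close>; servers and points are numbered
  from 1, and \<open>config\<close> stands for either kind of tuple.\<close>

type_synonym config = "nat \<Rightarrow> nat"

definition configs :: "nat \<Rightarrow> nat \<Rightarrow> config set" where
  "configs k n = {1..k} \<rightarrow>\<^sub>E {1..n}"

definition serves :: "nat \<Rightarrow> config \<Rightarrow> config \<Rightarrow> bool" where
  "serves k q r \<longleftrightarrow> (\<exists>i\<in>{1..k}. q i = r i)"

definition hamming :: "nat \<Rightarrow> config \<Rightarrow> config \<Rightarrow> nat" where
  "hamming k q q' = card {i\<in>{1..k}. q i \<noteq> q' i}"

text \<open>An algorithm maps its current configuration and the request to the distribution of its
  next configuration.\<close>

type_synonym algorithm = "config \<Rightarrow> config \<Rightarrow> config pmf"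

text \<open>The distribution \<open>p\<close> is meant to be supported on the server indices \<open>{1..k}\<close>.\<close>

definition memoryless :: "nat \<Rightarrow> nat pmf \<Rightarrow> algorithm" where
  "memoryless k p q r =
     (if serves k q r then return_pmf q else map_pmf (\<lambda>i. q(i := r i)) p)"

definition harmonic :: "nat \<Rightarrow> algorithm" where
  "harmonic k = memoryless k (pmf_of_set {1..k})"

text \<open>An adaptive online adversary sees the configurations the algorithm has occupied so far
  (in chronological order, starting with the initial one and ending with the current one). It
  either stops (\<open>None\<close>), or issues a request \<open>r\<close> and at once moves its own servers to a
  configuration \<open>a\<close> serving \<open>r\<close> (\<open>Some (r, a)\<close>), before it learns how the algorithm
  reacts to \<open>r\<close>.\<close>

type_synonym adversary = "config list \<Rightarrow> (config \<times> config) option"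

definition valid_adversary :: "nat \<Rightarrow> nat \<Rightarrow> adversary \<Rightarrow> bool" where
  "valid_adversary k n S \<longleftrightarrow>
     (\<forall>hs r a. hs \<noteq> [] \<longrightarrow> set hs \<subseteq> configs k n \<longrightarrow> S hs = Some (r, a) \<longrightarrow>
        r \<in> configs k n \<and> a \<in> configs k n \<and> serves k a r)"

text \<open>Joint distribution of the total costs (algorithm, adversary) over at most \<open>T\<close> further
  requests, where \<open>hs\<close> is the history of the algorithm's configurations and \<open>a\<close> is the
  current configuration of the adversary.\<close>

primrec play ::
  "nat \<Rightarrow> algorithm \<Rightarrow> adversary \<Rightarrow> nat \<Rightarrow> config list \<Rightarrow> config \<Rightarrow> (nat \<times> nat) pmf"
where
  "play k A S 0 hs a = return_pmf (0, 0)"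
| "play k A S (Suc T) hs a =
     (case S hs of
        None \<Rightarrow> return_pmf (0, 0)
      | Some (r, a') \<Rightarrow>
          bind_pmf (A (last hs) r) (\<lambda>q'.
            map_pmf (\<lambda>(x, y). (hamming k (last hs) q' + x, hamming k a a' + y))
              (play k A S T (hs @ [q']) a')))"

text \<open>The additive constant \<open>b\<close> may depend on \<open>k\<close>, \<open>n\<close> and the algorithm, but neither on
  the adversary nor on the number of requests.\<close>

definition competitive :: "nat \<Rightarrow> nat \<Rightarrow> algorithm \<Rightarrow> real \<Rightarrow> bool" where
  "competitive k n A c \<longleftrightarrow>
     (\<exists>b. \<forall>q0\<in>configs k n. \<forall>S T. valid_adversary k n S \<longrightarrow>
        measure_pmf.expectation (play k A S T [q0] q0) (\<lambda>(x, y). real x)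
          \<le> c * measure_pmf.expectation (play k A S T [q0] q0) (\<lambda>(x, y). real y) + b)"

text \<open>The value at 0 is a dummy: the sequence starts at index 1.\<close>

fun \<alpha> :: "nat \<Rightarrow> real" where
  "\<alpha> 0 = 0"
| "\<alpha> (Suc 0) = 1"
| "\<alpha> (Suc (Suc l)) = 1 + real (Suc l) * \<alpha> (Suc l)"

end

theory Submission
  imports Defs
begin

text \<open>Potential argument. If the algorithm's and the adversary's configurations are at Hamming
  distance \<open>l\<close>, the potential is \<open>\<Phi> l\<close>, whose increments are \<open>\<Phi> (l + 1) - \<Phi> l = k * \<alpha> (k - l)\<close>.
  The largest increment is \<open>k * \<alpha> k\<close>, which pays for each adversary move. When the algorithm has
  to move at distance \<open>l\<close>, the choice of at least one server decreases the distance and the choice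
  of exactly \<open>k - l\<close> servers increases it; the recurrence for \<open>\<alpha>\<close> is such that the potential
  then drops by at least 1 in expectation.\<close>

section \<open>The sequence \<open>\<alpha>\<close> and the potential\<close>

lemma alpha_Suc: "\<alpha> (Suc l) = 1 + real l * \<alpha> l"
  by (cases l) auto

lemma alpha_nonneg: "0 \<le> \<alpha> l"
  by (induction l) (auto simp: alpha_Suc simp del: \<alpha>.simps(2,3))

lemma alpha_mono: "l \<le> m \<Longrightarrow> \<alpha> l \<le> \<alpha> m"
proof (rule lift_Suc_mono_le[of \<alpha>])
  fix l
  show "\<alpha> l \<le> \<alpha> (Suc l)"
  proof (cases l)
    \<comment> \<open>The index is positive here, so the factor \<open>real l\<close> of the
      recurrence is at least 1. Index 0 carries the dummy value 0.\<close>
    case (Suc j)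
    have "1 * \<alpha> l \<le> real l * \<alpha> l"
      using Suc by (intro mult_right_mono alpha_nonneg) auto
    then show ?thesis by (simp add: alpha_Suc)
  qed simp
qed

text \<open>For \<open>j \<ge> k\<close> truncated subtraction gives \<open>\<alpha> 0 = 0\<close>,
  so the sum is constant from \<open>k\<close> on. Monotonicity and the growth bound thus hold for
  all arguments, even for sums of two distances that exceed \<open>k\<close>.\<close>

definition potential :: "nat \<Rightarrow> nat \<Rightarrow> real" where
  "potential k l = (\<Sum>j<l. real k * \<alpha> (k - j))"

lemma potential_0: "potential k 0 = 0"
  by (simp add: potential_def)

lemma potential_Suc: "potential k (Suc l) = potential k l + real k * \<alpha> (k - l)"
  by (simp add: potential_def)

lemma potential_mono: "l \<le> m \<Longrightarrow> potential k l \<le> potential k m"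
  by (rule lift_Suc_mono_le[of "potential k"]) (simp_all add: potential_Suc alpha_nonneg)

lemma potential_nonneg: "0 \<le> potential k l"
  using potential_mono[of 0 l k] by (simp add: potential_0)

lemma potential_add_le: "potential k (l + m) \<le> potential k l + real k * \<alpha> k * real m"
proof (induction m)
  case (Suc m)
  have "real k * \<alpha> (k - (l + m)) \<le> real k * \<alpha> k"
    by (intro mult_left_mono alpha_mono) auto
  with Suc show ?case by (simp add: potential_Suc algebra_simps)
qed simp

section \<open>Hamming distances and the drift of the potential\<close>

lemma hamming_triangle: "hamming k p s \<le> hamming k p q + hamming k q s"
proof -
  have "hamming k p s \<le> card ({i\<in>{1..k}. p i \<noteq> q i} \<union> {i\<in>{1..k}. q i \<noteq> s i})"
    unfolding hamming_def by (rule card_mono) auto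
  also have "\<dots> \<le> hamming k p q + hamming k q s"
    unfolding hamming_def by (rule card_Un_le)
  finally show ?thesis .
qed

lemma hamming_self: "hamming k q q = 0"
  by (simp add: hamming_def)

lemma hamming_update_self:
  assumes "i \<in> {1..k}" "q i \<noteq> x"
  shows "hamming k q (q(i := x)) = 1"
proof -
  have "{j\<in>{1..k}. q j \<noteq> (q(i := x)) j} = {i}" using assms by auto
  then show ?thesis by (simp add: hamming_def)
qed

text \<open>The distance changes by -1, 0 or 1, hence the additive form: both sides count the
  disagreements away from \<open>i\<close> plus the two indicators.\<close>

lemma hamming_update_add:
  assumes "i \<in> {1..k}"
  shows "hamming k (q(i := x)) a + of_bool (q i \<noteq> a i) = hamming k q a + of_bool (x \<noteq> a i)"
proof -
  let ?B = "{j\<in>{1..k}. j \<noteq> i \<and> q j \<noteq> a j}"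
  have split: "hamming k p a = card ?B + of_bool (p i \<noteq> a i)"
    if "\<And>j. j \<noteq> i \<Longrightarrow> p j = q j" for p
  proof -
    have "?B = {j\<in>{1..k}. j \<noteq> i \<and> p j \<noteq> a j}"
      using that by auto
    moreover have "{j\<in>{1..k}. p j \<noteq> a j}
        = {j\<in>{1..k}. j \<noteq> i \<and> p j \<noteq> a j} \<union> (if p i \<noteq> a i then {i} else {})"
      using assms by auto
    ultimately show ?thesis by (simp add: hamming_def)
  qed
  show ?thesis using split[of q] split[of "q(i := x)"] by simp
qed

lemma card_agree: "card {i\<in>{1..k}. q i = a i} = k - hamming k q a"
proof -
  have "{i\<in>{1..k}. q i = a i} = {1..k} - {i\<in>{1..k}. q i \<noteq> a i}" by auto
  also have "card \<dots> = card {1..k} - hamming k q a"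
    unfolding hamming_def by (rule card_Diff_subset) auto
  finally show ?thesis by simp
qed

text \<open>The adversary already stands at \<open>a\<close>. The left side is \<open>k\<close>
  times an expectation over the chosen server, and the summand 1 is the cost of its move.\<close>

lemma potential_drift:
  assumes "\<not> serves k q r" "serves k a r"
  shows "(\<Sum>i\<in>{1..k}. 1 + potential k (hamming k (q(i := r i)) a))
           \<le> real k * potential k (hamming k q a)"
proof -
  define d where "d = hamming k q a"
  \<comment> \<open>\<open>D\<close> is the rise of the potential from distance \<open>d\<close> to
    \<open>d + 1\<close>, and \<open>E\<close> the rise from \<open>d - 1\<close> to
    \<open>d\<close>; the index \<open>k - (d - 1)\<close> is written as a successor to match the
    recurrence.\<close>
  define D where "D = real k * \<alpha> (k - d)"
  define E where "E = real k * \<alpha> (Suc (k - d))"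
  obtain i0 where i0: "i0 \<in> {1..k}" "a i0 = r i0"
    using assms(2) by (auto simp: serves_def)
  have ne: "q i \<noteq> r i" if "i \<in> {1..k}" for i
    using assms(1) that by (auto simp: serves_def)
  have "{i\<in>{1..k}. q i \<noteq> a i} \<noteq> {}" using i0 ne[of i0] by auto
  then have "d > 0" by (simp add: d_def hamming_def card_gt_0_iff)
  have "d \<le> card {1..k}" unfolding d_def hamming_def by (rule card_mono) auto
  then have dk: "d \<le> k" by simp
  have drop: "potential k (d - 1) = potential k d - E"
    using potential_Suc[of k "d - 1"] \<open>d > 0\<close> dk by (simp add: E_def Suc_diff_le)
  \<comment> \<open>Only \<open>i0\<close> is credited with a decrease; any other server that
    reaches the adversary's point is bounded by monotonicity. \<open>D\<close> and \<open>E\<close>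
    never occur for the same \<open>i\<close>, since \<open>q\<close> and \<open>a\<close> differ at
    \<open>i0\<close>.\<close>
  have step: "1 + potential k (hamming k (q(i := r i)) a)
      \<le> 1 + potential k d + (if q i = a i then D else 0) - (if i = i0 then E else 0)"
    if i: "i \<in> {1..k}" for i
  proof -
    have h: "hamming k (q(i := r i)) a + of_bool (q i \<noteq> a i) = d + of_bool (r i \<noteq> a i)"
      unfolding d_def by (rule hamming_update_add[OF i])
    consider "i = i0" | "i \<noteq> i0" "q i = a i" | "i \<noteq> i0" "q i \<noteq> a i" by blast
    then show ?thesis
    proof cases
      case 1
      then have "hamming k (q(i := r i)) a = d - 1" "q i \<noteq> a i" using h i0 ne[OF i] by auto
      then show ?thesis using 1 drop by simp
    next
      case 2
      then have "hamming k (q(i := r i)) a = Suc d" using h ne[OF i] by auto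
      then show ?thesis using 2 by (simp add: potential_Suc D_def)
    next
      case 3
      then have "hamming k (q(i := r i)) a \<le> d" using h by (cases "r i = a i") auto
      then show ?thesis using 3 by (simp add: potential_mono)
    qed
  qed
  have "(\<Sum>i\<in>{1..k}. 1 + potential k (hamming k (q(i := r i)) a))
      \<le> (\<Sum>i\<in>{1..k}. 1 + potential k d + (if q i = a i then D else 0) - (if i = i0 then E else 0))"
    by (rule sum_mono) (rule step)
  also have "\<dots> = real k * (1 + potential k d) + real (k - d) * D - E"
  proof -
    have "(\<Sum>i\<in>{1..k}. if q i = a i then D else 0) = real (k - d) * D"
      using card_agree[of k q a] by (simp add: sum.If_cases Int_def d_def)
    moreover have "(\<Sum>i\<in>{1..k}. if i = i0 then E else 0) = E"
      using i0 by simp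
    ultimately show ?thesis
      by (simp add: sum.distrib sum_subtractf distrib_left)
  qed
  \<comment> \<open>The recurrence gives \<open>E = k + (k - d) * D\<close>, which absorbs both the
    moving costs and the increases. At \<open>d = k\<close> the factor \<open>k - d\<close>
    vanishes, so the dummy \<open>\<alpha> 0\<close> does no harm.\<close>
  also have "\<dots> = real k * potential k d"
    unfolding D_def E_def alpha_Suc by (simp add: algebra_simps)
  finally show ?thesis by (simp add: d_def)
qed

section \<open>Expected costs over a whole play\<close>

lemma finite_set_pmf_harmonic: "k \<ge> 1 \<Longrightarrow> finite (set_pmf (harmonic k q r))"
  by (simp add: harmonic_def memoryless_def)

lemma harmonic_in_configs:
  assumes "k \<ge> 1" "q \<in> configs k n" "r \<in> configs k n" "q' \<in> set_pmf (harmonic k q r)"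
  shows "q' \<in> configs k n"
  using assms
  by (auto simp: harmonic_def memoryless_def configs_def PiE_iff extensional_def split: if_splits)

lemma finite_set_pmf_play:
  assumes "\<And>q r. finite (set_pmf (A q r))"
  shows "finite (set_pmf (play k A S T hs a))"
  by (induction T arbitrary: hs a) (auto split: option.split intro!: assms)

text \<open>Conditioning on the first stage: finite supports turn both expectations into finite
  sums, compared term by term.\<close>

lemma expectation_bind_le:
  fixes h :: "'b \<Rightarrow> real"
  assumes "finite (set_pmf p)" "\<And>x. x \<in> set_pmf p \<Longrightarrow> finite (set_pmf (f x))"
    and "\<And>x. x \<in> set_pmf p \<Longrightarrow> measure_pmf.expectation (f x) h \<le> g x"
  shows "measure_pmf.expectation (bind_pmf p f) h \<le> measure_pmf.expectation p g"
proof -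
  have "measure_pmf.expectation (bind_pmf p f) h
      = (\<Sum>x\<in>set_pmf p. pmf p x * measure_pmf.expectation (f x) h)"
    using assms by (subst pmf_expectation_bind[of "set_pmf p"]) auto
  also have "\<dots> \<le> (\<Sum>x\<in>set_pmf p. pmf p x * g x)"
    using assms by (intro sum_mono mult_left_mono) auto
  also have "\<dots> = measure_pmf.expectation p g"
    using assms(1) by (subst integral_measure_pmf[of "set_pmf p"]) auto
  finally show ?thesis .
qed

lemma harmonic_step:
  assumes "k \<ge> 1" "serves k a r"
  shows "measure_pmf.expectation (harmonic k q r)
           (\<lambda>q'. real (hamming k q q') + potential k (hamming k q' a))
         \<le> potential k (hamming k q a)"
proof (cases "serves k q r")
  case True
  then show ?thesis by (simp add: harmonic_def memoryless_def hamming_self)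
next
  case False
  then have "hamming k q (q(i := r i)) = 1" if "i \<in> {1..k}" for i
    using that by (intro hamming_update_self) (auto simp: serves_def)
  then have "measure_pmf.expectation (harmonic k q r)
           (\<lambda>q'. real (hamming k q q') + potential k (hamming k q' a))
      = (\<Sum>i\<in>{1..k}. 1 + potential k (hamming k (q(i := r i)) a)) / real k"
    using False assms(1) by (simp add: harmonic_def memoryless_def integral_pmf_of_set)
  also have "\<dots> \<le> potential k (hamming k q a)"
    using potential_drift[OF False assms(2)] assms(1) by (simp add: field_simps)
  finally show ?thesis .
qed

text \<open>The adversary's cost is random too, as it reacts to the history, so both costs enter one
  random variable. The induction needs arbitrary \<open>hs\<close> and \<open>a\<close>, since the
  distance is no longer 0 after the first request.\<close>

lemma play_harmonic_le:
  assumes "k \<ge> 1" and valid: "valid_adversary k n S"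
    and "hs \<noteq> []" "set hs \<subseteq> configs k n"
  shows "measure_pmf.expectation (play k (harmonic k) S T hs a)
           (\<lambda>(x, y). real x - real k * \<alpha> k * real y)
         \<le> potential k (hamming k (last hs) a)"
  using assms(3,4)
proof (induction T arbitrary: hs a)
  case 0
  then show ?case by (simp add: potential_nonneg)
next
  case (Suc T)
  let ?c = "real k * \<alpha> k"
  let ?h = "\<lambda>(x, y). real x - ?c * real y"
  let ?q = "last hs"
  have fin: "finite (set_pmf (play k (harmonic k) S T hs' a'))" for hs' a'
    using assms(1) by (intro finite_set_pmf_play finite_set_pmf_harmonic)
  show ?case
  proof (cases "S hs")
    case None
    then show ?thesis by (simp add: potential_nonneg)
  next
    case (Some ra)
    obtain r a' where ra: "ra = (r, a')" by force
    have r: "r \<in> configs k n" and sv: "serves k a' r"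
      using valid Suc.prems Some ra by (auto simp: valid_adversary_def)
    have q: "?q \<in> configs k n" using Suc.prems by auto
    let ?f = "\<lambda>q'. map_pmf (\<lambda>(x, y). (hamming k ?q q' + x, hamming k a a' + y))
              (play k (harmonic k) S T (hs @ [q']) a')"
    have f: "measure_pmf.expectation (?f q') ?h
        \<le> (real (hamming k ?q q') + potential k (hamming k q' a')) - ?c * real (hamming k a a')"
      if q': "q' \<in> set_pmf (harmonic k ?q r)" for q'
    proof -
      let ?P = "play k (harmonic k) S T (hs @ [q']) a'"
      have "measure_pmf.expectation (?f q') ?h = measure_pmf.expectation ?P
          (\<lambda>z. ?h z + (real (hamming k ?q q') - ?c * real (hamming k a a')))"
        by (simp add: case_prod_beta algebra_simps)
      also have "\<dots> = measure_pmf.expectation ?P ?h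
          + (real (hamming k ?q q') - ?c * real (hamming k a a'))"
        by (subst Bochner_Integration.integral_add)
          (auto intro!: integrable_measure_pmf_finite fin)
      also have "measure_pmf.expectation ?P ?h \<le> potential k (hamming k (last (hs @ [q'])) a')"
        using Suc.prems harmonic_in_configs[OF assms(1) q r q'] by (intro Suc.IH) auto
      finally show ?thesis by simp
    qed
    have "measure_pmf.expectation (play k (harmonic k) S (Suc T) hs a) ?h
        = measure_pmf.expectation (bind_pmf (harmonic k ?q r) ?f) ?h"
      by (simp add: Some ra)
    also have "\<dots> \<le> measure_pmf.expectation (harmonic k ?q r)
        (\<lambda>q'. (real (hamming k ?q q') + potential k (hamming k q' a')) - ?c * real (hamming k a a'))"
      using assms(1) by (intro expectation_bind_le f) (auto simp: finite_set_pmf_harmonic fin)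
    \<comment> \<open>The adversary commits to \<open>a'\<close> before seeing \<open>q'\<close>, so
      its cost in this round is a constant.\<close>
    also have "\<dots> = measure_pmf.expectation (harmonic k ?q r)
        (\<lambda>q'. real (hamming k ?q q') + potential k (hamming k q' a')) - ?c * real (hamming k a a')"
      using assms(1) by (subst Bochner_Integration.integral_diff)
        (auto intro!: integrable_measure_pmf_finite finite_set_pmf_harmonic)
    also have "\<dots> \<le> potential k (hamming k ?q a') - ?c * real (hamming k a a')"
      using harmonic_step[OF assms(1) sv] by simp
    \<comment> \<open>The adversary's move lengthens the distance by at most its own cost, and each
      unit of that raises the potential by at most \<open>?c\<close>.\<close>
    also have "\<dots> \<le> potential k (hamming k ?q a)"
      using potential_mono[OF hamming_triangle[of k ?q a' a], of k]
        potential_add_le[of k "hamming k ?q a" "hamming k a a'"] by simp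
    finally show ?thesis .
  qed
qed

theorem theorem1:
  fixes k n :: nat
  assumes "k \<ge> 1"
  shows "competitive k n (harmonic k) (real k * \<alpha> k)"
  unfolding competitive_def
\<comment> \<open>The additive constant is 0 because both sides start at \<open>q0\<close>, where
  the potential vanishes.\<close>
proof (intro exI[of _ 0] ballI allI impI)
  fix q0 S T
  assume q0: "q0 \<in> configs k n" and valid: "valid_adversary k n S"
  let ?P = "play k (harmonic k) S T [q0] q0"
  let ?c = "real k * \<alpha> k"
  have int: "integrable (measure_pmf ?P) f" for f :: "nat \<times> nat \<Rightarrow> real"
    using assms
    by (intro integrable_measure_pmf_finite finite_set_pmf_play finite_set_pmf_harmonic)
  have "measure_pmf.expectation ?P (\<lambda>(x, y). real x)
      - ?c * measure_pmf.expectation ?P (\<lambda>(x, y). real y)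
      = measure_pmf.expectation ?P (\<lambda>z. (case z of (x, y) \<Rightarrow> real x)
          - ?c * (case z of (x, y) \<Rightarrow> real y))"
    by (simp add: int)
  also have "\<dots> = measure_pmf.expectation ?P (\<lambda>(x, y). real x - ?c * real y)"
    by (intro Bochner_Integration.integral_cong) auto
  also have "\<dots> \<le> 0"
    using play_harmonic_le[OF assms valid, of "[q0]" T q0] q0
    by (simp add: hamming_self potential_0)
  finally show "measure_pmf.expectation ?P (\<lambda>(x, y). real x)
      \<le> ?c * measure_pmf.expectation ?P (\<lambda>(x, y). real y) + 0"
    by simp
qed

end
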